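(* Let $m,n\in\mathbb N$ and let $(V_1,V_2)$ be a pair of commuting isometries on a Hilbert space $\mathcal H$. Then $H(V_1V_2,V_2)\geq 0$ if and only if $V_2^n(\mathcal W_{m,0})\subseteq\mathcal W_{m,0}$, where $\mathcal W_{m,0}=\mathcal H\ominus V_1^m\mathcal H=\ker V_1^{*m}$.
   Context: Hilbert spaces are complex; $\mathbb N=\{1,2,3,\dots\}$. For a pair $(T_1,T_2)$ of commuting isometries on $\mathcal H$, $H(T_1,T_2):=T_2T_2^*-T_1T_1^*-T_2^2T_2^{*2}+T_1T_2T_1^*T_2^*$; here it is applied to the commuting isometric pair $(T_1,T_2)=(V_1V_2,V_2)$. *)

theory Defs
  imports "HOL-Analysis.Inner_Product"
begin

text \<open>
  A complex inner product space is a real inner product space (from which it inherits norm and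
  metric) with a compatible complex scalar multiplication and sesquilinear form, linear in the
  first argument. The real inner product is forced to be the real part of the complex one, so
  positive definiteness of \<open>cinner\<close> and \<open>norm x = sqrt (cinner x x)\<close> come from
  \<^class>\<open>real_inner\<close>.
\<close>

class complex_inner = real_inner +
  fixes scaleC :: "complex \<Rightarrow> 'a \<Rightarrow> 'a"  (infixr "*\<^sub>C" 75)
    and cinner :: "'a \<Rightarrow> 'a \<Rightarrow> complex"
  assumes scaleC_add_right: "a *\<^sub>C (x + y) = a *\<^sub>C x + a *\<^sub>C y"
    and scaleC_add_left: "(a + b) *\<^sub>C x = a *\<^sub>C x + b *\<^sub>C x"
    and scaleC_scaleC: "a *\<^sub>C b *\<^sub>C x = (a * b) *\<^sub>C x"
    and scaleC_one: "1 *\<^sub>C x = x"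
    and scaleR_scaleC: "r *\<^sub>R x = complex_of_real r *\<^sub>C x"
    and cinner_commute: "cinner x y = cnj (cinner y x)"
    and cinner_add_left: "cinner (x + y) z = cinner x z + cinner y z"
    and cinner_scaleC_left: "cinner (a *\<^sub>C x) y = a * cinner x y"
    and inner_eq_Re_cinner: "inner x y = Re (cinner x y)"

class chilbert_space = complex_inner + complete_space

instantiation complex :: chilbert_space
begin
definition "scaleC (a::complex) (x::complex) = a * x"
definition "cinner (x::complex) y = x * cnj y"
instance
  by standard
    (auto simp: scaleC_complex_def cinner_complex_def algebra_simps scaleR_conv_of_real
      inner_complex_def)
end

lemma vector_space_scaleC: "vector_space (scaleC :: complex \<Rightarrow> 'a \<Rightarrow> 'a::complex_inner)"
  by (rule vector_space.intro)
    (rule scaleC_add_right scaleC_add_left scaleC_scaleC scaleC_one)+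

abbreviation clinear :: "('a::complex_inner \<Rightarrow> 'b::complex_inner) \<Rightarrow> bool" where
  "clinear \<equiv> Vector_Spaces.linear scaleC scaleC"

definition isometric_op :: "('a::chilbert_space \<Rightarrow> 'a) \<Rightarrow> bool" where
  "isometric_op V \<longleftrightarrow> clinear V \<and> (\<forall>x. norm (V x) = norm x)"

text \<open>Determined uniquely whenever an adjoint exists; see \<open>cadjoint_works\<close> below.\<close>

definition cadjoint :: "('a::chilbert_space \<Rightarrow> 'a) \<Rightarrow> 'a \<Rightarrow> 'a" where
  "cadjoint T = (SOME S. \<forall>x y. cinner (T x) y = cinner x (S y))"

definition positive_op :: "('a::chilbert_space \<Rightarrow> 'a) \<Rightarrow> bool" where
  "positive_op A \<longleftrightarrow> clinear A \<and> (\<forall>x. cinner (A x) x \<in> \<real> \<and> 0 \<le> Re (cinner (A x) x))"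

definition H_op :: "('a::chilbert_space \<Rightarrow> 'a) \<Rightarrow> ('a \<Rightarrow> 'a) \<Rightarrow> 'a \<Rightarrow> 'a" where
  "H_op T1 T2 = (\<lambda>x.
     T2 (cadjoint T2 x) - T1 (cadjoint T1 x) - (T2 ^^ 2) ((cadjoint T2 ^^ 2) x)
       + T1 (T2 (cadjoint T1 (cadjoint T2 x))))"

text \<open>
  \<open>ortho_compl S\<close> is the orthogonal difference of the whole space and \<open>S\<close>.
\<close>

definition ortho_compl :: "'a::chilbert_space set \<Rightarrow> 'a set" where
  "ortho_compl S = {x. \<forall>y\<in>S. cinner x y = 0}"

definition W_space :: "('a::chilbert_space \<Rightarrow> 'a) \<Rightarrow> nat \<Rightarrow> 'a set" where
  "W_space V m = ortho_compl (range (V ^^ m))"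

text \<open>
  The remaining facts show that \<^const>\<open>cadjoint\<close> is the genuine adjoint of every bounded operator
  (existence by the Riesz representation theorem) and that \<^const>\<open>W_space\<close> is also
  the kernel of the \<open>m\<close>-th power of the adjoint.
\<close>

lemma riesz_real:
  fixes f :: "'a::{real_inner, complete_space} \<Rightarrow> real"
  assumes "bounded_linear f"
  shows "\<exists>z. \<forall>x. f x = inner x z"
proof -
  interpret f: bounded_linear f by fact
  obtain K where K: "\<And>x. norm (f x) \<le> norm x * K" using f.bounded by blast
  define g where "g x = (norm x)\<^sup>2 - 2 * f x" for x
  have lower: "- K\<^sup>2 \<le> g x" for x
  proof -
    have "f x \<le> norm x * K" using K[of x] by simp
    moreover have "0 \<le> (norm x - K)\<^sup>2" by simp
    ultimately show ?thesis unfolding g_def by (simp add: power2_diff)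
  qed
  define I where "I = Inf (range g)"
  have bb: "bdd_below (range g)" using lower by (intro bdd_belowI[of _ "- K\<^sup>2"]) auto
  have I_le: "I \<le> g x" for x unfolding I_def by (rule cInf_lower[OF _ bb]) auto
  have "\<exists>x. g x < I + e" if "e > 0" for e
    using cInf_lessD[of "range g" "I + e"] that unfolding I_def by auto
  then have "\<forall>n. \<exists>x. g x < I + inverse (real (Suc n))" by simp
  then obtain X where X: "\<And>n. g (X n) < I + inverse (real (Suc n))" by metis
  have para: "(norm (x - y))\<^sup>2 = 2 * g x + 2 * g y - 4 * g ((1/2) *\<^sub>R (x + y))" for x y
    unfolding g_def power2_norm_eq_inner
    by (simp add: f.add f.scaleR inner_add_left inner_add_right inner_diff_left
        inner_diff_right inner_commute algebra_simps)
  have dist: "(norm (X a - X b))\<^sup>2 < 4 * inverse (real (Suc N))" if "a \<ge> N" "b \<ge> N" for a b N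
  proof -
    have "inverse (real (Suc a)) \<le> inverse (real (Suc N))"
      "inverse (real (Suc b)) \<le> inverse (real (Suc N))" using that by (auto intro!: le_imp_inverse_le)
    with X[of a] X[of b] I_le[of "(1/2) *\<^sub>R (X a + X b)"] para[of "X a" "X b"]
    show ?thesis by linarith
  qed
  have "Cauchy X"
  proof (rule CauchyI)
    fix e :: real assume "e > 0"
    then obtain N where N: "inverse (real (Suc N)) < e\<^sup>2 / 4"
      using reals_Archimedean[of "e\<^sup>2 / 4"] by auto
    have "norm (X a - X b) < e" if "a \<ge> N" "b \<ge> N" for a b
      using dist[OF that] N \<open>e > 0\<close> by (intro power_less_imp_less_base[of _ 2 e]) auto
    then show "\<exists>M. \<forall>m\<ge>M. \<forall>n\<ge>M. norm (X m - X n) < e" by blast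
  qed
  then obtain z where z: "X \<longlonglongrightarrow> z" using Cauchy_convergent_iff convergent_def by blast
  have "(\<lambda>n. g (X n)) \<longlonglongrightarrow> g z"
    unfolding g_def by (intro tendsto_intros f.tendsto z)
  moreover have "(\<lambda>n. I + inverse (real (Suc n))) \<longlonglongrightarrow> I + 0"
    by (intro tendsto_intros LIMSEQ_inverse_real_of_nat)
  ultimately have "g z \<le> I + 0"
    by (rule LIMSEQ_le) (use X less_imp_le in blast)
  then have gz: "g z \<le> g x" for x using I_le[of x] by simp
  have "f x = inner x z" for x
  proof -
    define b where "b = inner x z - f x"
    have q: "0 \<le> t\<^sup>2 * (norm x)\<^sup>2 + 2 * t * b" for t
      using gz[of "z + t *\<^sub>R x"] unfolding g_def power2_norm_eq_inner b_def
      by (simp add: f.add f.scaleR inner_add_left inner_add_right inner_commute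
          power2_eq_square algebra_simps)
    have "b = 0"
    proof (cases "x = 0")
      case True then show ?thesis by (simp add: b_def f.zero)
    next
      case False
      define N where "N = (norm x)\<^sup>2"
      have "N > 0" using False by (simp add: N_def)
      then have "(- b / N)\<^sup>2 * N + 2 * (- b / N) * b = - (b\<^sup>2 / N)"
        by (simp add: field_simps power2_eq_square)
      with q[of "- b / N"] have "b\<^sup>2 / N \<le> 0" by (simp add: N_def)
      with \<open>N > 0\<close> show ?thesis by (simp add: divide_le_0_iff)
    qed
    then show ?thesis by (simp add: b_def)
  qed
  then show ?thesis by blast
qed

lemma clinear_scaleC: "clinear T \<Longrightarrow> T (a *\<^sub>C x) = a *\<^sub>C T x"
  unfolding Vector_Spaces.linear_iff by blast

lemma clinear_imp_linear:
  assumes "clinear T"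
  shows "linear T"
proof (rule linearI)
  show "T (x + y) = T x + T y" for x y
    using assms unfolding Vector_Spaces.linear_iff by blast
  show "T (r *\<^sub>R x) = r *\<^sub>R T x" for r x
    unfolding scaleR_scaleC by (rule clinear_scaleC[OF assms])
qed

lemma Im_cinner: "Im (cinner x y) = - inner (\<i> *\<^sub>C x) y"
  by (simp add: inner_eq_Re_cinner cinner_scaleC_left)

lemma cadjoint_works:
  fixes T :: "'a::chilbert_space \<Rightarrow> 'a"
  assumes T: "clinear T" and bdd: "bounded_linear T"
  shows "cinner (T x) y = cinner x (cadjoint T y)"
proof -
  have "\<exists>z. \<forall>x. cinner (T x) y = cinner x z" for y
  proof -
    have "bounded_linear (\<lambda>x. inner (T x) y)"
      by (rule bounded_linear_compose[OF bounded_linear_inner_left bdd])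
    then obtain z where z: "\<And>x. inner (T x) y = inner x z" using riesz_real by blast
    have "cinner (T x) y = cinner x z" for x
    proof (rule complex_eqI)
      show "Re (cinner (T x) y) = Re (cinner x z)"
        using z[of x] unfolding inner_eq_Re_cinner .
      show "Im (cinner (T x) y) = Im (cinner x z)"
        using z[of "\<i> *\<^sub>C x"] unfolding Im_cinner clinear_scaleC[OF T] by simp
    qed
    then show ?thesis by blast
  qed
  then have "\<exists>S. \<forall>y x. cinner (T x) y = cinner x (S y)" by (intro choice allI)
  then have "\<exists>S. \<forall>x y. cinner (T x) y = cinner x (S y)" by blast
  from someI_ex[OF this] show ?thesis unfolding cadjoint_def by blast
qed

lemma isometric_op_adjoint:
  assumes "isometric_op V"
  shows "cinner (V x) y = cinner x (cadjoint V y)"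
proof (rule cadjoint_works)
  show V: "clinear V" using assms by (simp add: isometric_op_def)
  show "bounded_linear V"
  proof (rule bounded_linear_intro)
    show "V (x + y) = V x + V y" for x y by (rule linear_add[OF clinear_imp_linear[OF V]])
    show "V (r *\<^sub>R x) = r *\<^sub>R V x" for r x by (rule linear_scale[OF clinear_imp_linear[OF V]])
    show "norm (V x) \<le> norm x * 1" for x using assms by (simp add: isometric_op_def)
  qed
qed

lemma W_space_eq_kernel:
  assumes V: "isometric_op V"
  shows "W_space V m = {x. (cadjoint V ^^ m) x = 0}"
proof -
  have pow: "cinner ((V ^^ k) y) x = cinner y ((cadjoint V ^^ k) x)" for k x y
  proof (induction k arbitrary: x)
    case 0
    show ?case by simp
  next
    case (Suc k)
    have "cinner ((V ^^ Suc k) y) x = cinner ((V ^^ k) y) (cadjoint V x)"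
      by (simp add: isometric_op_adjoint[OF V])
    also have "\<dots> = cinner y ((cadjoint V ^^ Suc k) x)"
      unfolding Suc.IH funpow_Suc_right by simp
    finally show ?case .
  qed
  have nondeg: "(\<forall>y. cinner y z = 0) \<longleftrightarrow> z = 0" for z :: 'a
  proof
    assume "\<forall>y. cinner y z = 0"
    then have "inner z z = 0" by (simp add: inner_eq_Re_cinner)
    then show "z = 0" by simp
  next
    assume "z = 0"
    have "cinner 0 y = 0" for y :: 'a using cinner_add_left[of 0 0 y] by simp
    then have "cinner y 0 = 0" for y :: 'a by (subst cinner_commute) simp
    with \<open>z = 0\<close> show "\<forall>y. cinner y z = 0" by simp
  qed
  have "cinner x y = 0 \<longleftrightarrow> cinner y x = 0" for x y :: 'a
    by (subst cinner_commute) simp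
  then have "x \<in> W_space V m \<longleftrightarrow> (\<forall>y. cinner ((V ^^ m) y) x = 0)" for x
    unfolding W_space_def ortho_compl_def by blast
  then show ?thesis by (auto simp: pow nondeg)
qed

end

theory Submission
  imports Defs
begin

text \<open>
  Both conditions are equivalent to \<open>V\<^sub>1\<^sup>* V\<^sub>2 = V\<^sub>2 V\<^sub>1\<^sup>*\<close>. For commuting isometries \<open>A, B\<close> put
  \<open>C = A\<^sup>* B - B A\<^sup>*\<close>; then \<open>\<parallel>A\<^sup>* B y\<parallel>\<^sup>2 = \<parallel>A\<^sup>* y\<parallel>\<^sup>2 + \<parallel>C y\<parallel>\<^sup>2\<close>.
  If \<open>A\<^sup>*\<close> commutes with \<open>B\<^sup>n\<close>, so does \<open>C\<close>, whence \<open>\<parallel>C B\<^sup>n\<^sup>k y\<parallel> = \<parallel>C y\<parallel>\<close>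
  for all \<open>k\<close>; since \<open>\<parallel>A\<^sup>* B\<^sup>j y\<parallel>\<close> stays below \<open>\<parallel>y\<parallel>\<close>, this forces \<open>C = 0\<close>. Exchanging
  the roles of the two isometries by taking adjoints removes the exponent of \<open>V\<^sub>1\<close> as well.
  Invariance of \<open>ker A\<^sup>*\<close> under \<open>B\<close> is the relation \<open>C = 0\<close>, because \<open>y - A A\<^sup>* y\<close> lies in
  \<open>ker A\<^sup>*\<close>. Finally, with \<open>f y = \<parallel>y\<parallel>\<^sup>2 - \<parallel>A\<^sup>* y\<parallel>\<^sup>2\<close> and \<open>y = B\<^sup>* x\<close>, the quadratic form of
  \<open>H(A B, B)\<close> at \<open>x\<close> is \<open>f y - f (B\<^sup>* y)\<close>.
\<close>

section \<open>Sesquilinear form and uniqueness of adjoints\<close>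

lemma cinner_eq_zero_all: "z = 0" if "\<And>x. cinner x z = 0" for z :: "'a::complex_inner"
  using that[of z] inner_eq_Re_cinner[of z z] by simp

lemma cinner_add_right: "cinner x (y + z) = cinner x y + cinner x z"
  by (metis cinner_add_left cinner_commute complex_cnj_add)

lemma cinner_scaleC_right: "cinner x (a *\<^sub>C y) = cnj a * cinner x y"
  by (metis cinner_scaleC_left cinner_commute complex_cnj_mult)

lemma cinner_diff_left: "cinner (x - y) z = cinner x z - cinner y z"
  by (metis add_diff_cancel_right' cinner_add_left diff_add_cancel)

lemma cinner_diff_right: "cinner x (y - z) = cinner x y - cinner x z"
  by (metis add_diff_cancel_right' cinner_add_right diff_add_cancel)

lemma cinner_ext: "y = z" if "\<And>x. cinner x y = cinner x z" for y z :: "'a::complex_inner"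
  using cinner_eq_zero_all[of "y - z"] that by (simp add: cinner_diff_right)

lemma cinner_self: "cinner x x = complex_of_real ((norm x)\<^sup>2)"
proof (rule complex_eqI)
  show "Re (cinner x x) = Re (complex_of_real ((norm x)\<^sup>2))"
    by (simp add: power2_norm_eq_inner inner_eq_Re_cinner)
  have "Im (cinner x x) = - Im (cinner x x)"
    by (metis cinner_commute cnj.simps(2))
  then show "Im (cinner x x) = Im (complex_of_real ((norm x)\<^sup>2))" by simp
qed

lemma clinear_iff:
  "clinear T \<longleftrightarrow> (\<forall>x y. T (x + y) = T x + T y) \<and> (\<forall>a x. T (a *\<^sub>C x) = a *\<^sub>C T x)"
  by (simp add: Vector_Spaces.linear_iff vector_space_scaleC)

lemma scaleC_diff_right: "a *\<^sub>C (x - y) = a *\<^sub>C x - a *\<^sub>C y"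
  by (metis add_diff_cancel_right' scaleC_add_right diff_add_cancel)

text \<open>\<open>S\<close> shows that the choice in \<open>cadjoint\<close> succeeds, and
  nondegeneracy of \<open>cinner\<close> leaves only one adjoint to choose.\<close>

lemma cadjoint_eqI:
  assumes "\<And>x y. cinner (T x) y = cinner x (S y)"
  shows "cadjoint T = S"
proof -
  have adj: "\<forall>x y. cinner (T x) y = cinner x (cadjoint T y)"
    unfolding cadjoint_def by (rule someI[of _ S]) (use assms in blast)
  show ?thesis
  proof (rule ext, rule cinner_ext)
    show "cinner x (cadjoint T y) = cinner x (S y)" for x y
      using adj[rule_format, of x y] assms[of x y] by (rule trans[OF sym])
  qed
qed

section \<open>Isometries and their adjoints\<close>

lemma isometric_op_norm: "isometric_op V \<Longrightarrow> norm (V x) = norm x"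
  by (simp add: isometric_op_def)

lemma isometric_op_diff:
  assumes "isometric_op V"
  shows "V (x - y) = V x - V y"
  using assms clinear_imp_linear linear_diff unfolding isometric_op_def by blast

lemma isometric_op_compose: "isometric_op V \<Longrightarrow> isometric_op U \<Longrightarrow> isometric_op (V \<circ> U)"
  by (simp add: isometric_op_def clinear_iff)

lemma isometric_op_funpow: "isometric_op V \<Longrightarrow> isometric_op (V ^^ k)"
proof (induction k)
  case 0
  show ?case by (simp add: isometric_op_def clinear_iff)
next
  case (Suc k)
  then show ?case by (simp only: funpow.simps isometric_op_compose)
qed

lemma isometric_op_adjoint':
  assumes "isometric_op V"
  shows "cinner (cadjoint V x) y = cinner x (V y)"
  by (metis assms cinner_commute isometric_op_adjoint)

lemma clinear_cadjoint:
  assumes "isometric_op V"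
  shows "clinear (cadjoint V)"
  unfolding clinear_iff
  by (intro conjI allI; rule cinner_ext)
    (simp_all add: cinner_add_right cinner_scaleC_right flip: isometric_op_adjoint[OF assms])

lemma cadjoint_diff:
  assumes "isometric_op V"
  shows "cadjoint V (x - y) = cadjoint V x - cadjoint V y"
  using clinear_cadjoint[OF assms] clinear_imp_linear linear_diff by blast

lemma cadjoint_compose:
  assumes "isometric_op V" "isometric_op U"
  shows "cadjoint (V \<circ> U) = cadjoint U \<circ> cadjoint V"
  by (rule cadjoint_eqI) (simp add: isometric_op_adjoint[OF assms(1)] isometric_op_adjoint[OF assms(2)])

text \<open>Polarization gives the real part; the imaginary part is the real one at
  \<open>\<i> *\<^sub>C x\<close>, up to sign.\<close>

lemma cinner_isometric_op:
  assumes "isometric_op V"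
  shows "cinner (V x) (V y) = cinner x y"
proof -
  have iso: "inner (V u) (V v) = inner u v" for u v
  proof -
    have "V (u + v) = V u + V v" using assms by (simp add: isometric_op_def clinear_iff)
    then have "norm (V u + V v) = norm (u + v)" using isometric_op_norm[OF assms] by metis
    then show ?thesis using isometric_op_norm[OF assms] by (simp add: dot_norm)
  qed
  have "V (\<i> *\<^sub>C x) = \<i> *\<^sub>C V x" using assms by (simp add: isometric_op_def clinear_iff)
  then show ?thesis
    using iso[of x y] iso[of "\<i> *\<^sub>C x" y]
    by (intro complex_eqI) (simp_all add: Im_cinner inner_eq_Re_cinner)
qed

lemma cadjoint_isometric_op:
  assumes "isometric_op V"
  shows "cadjoint V (V x) = x"
  by (rule cinner_ext) (simp add: cinner_isometric_op[OF assms] flip: isometric_op_adjoint[OF assms])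

text \<open>Pythagoras: \<open>V V*\<close> is the orthogonal projection onto the range of
  \<open>V\<close>, and \<open>V\<close> preserves the norm of \<open>V* x\<close>.\<close>

lemma norm_diff_range_projection:
  assumes "isometric_op V"
  shows "(norm (x - V (cadjoint V x)))\<^sup>2 = (norm x)\<^sup>2 - (norm (cadjoint V x))\<^sup>2"
proof -
  have "cinner x (V (cadjoint V x)) = cinner (cadjoint V x) (cadjoint V x)"
    by (simp add: isometric_op_adjoint'[OF assms])
  then have "complex_of_real ((norm (x - V (cadjoint V x)))\<^sup>2)
      = complex_of_real ((norm x)\<^sup>2 - (norm (cadjoint V x))\<^sup>2)"
    unfolding of_real_diff cinner_self[symmetric]
    by (simp add: cinner_diff_left cinner_diff_right isometric_op_adjoint[OF assms]
        cadjoint_isometric_op[OF assms])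
  then show ?thesis using of_real_eq_iff by blast
qed

lemma norm_cadjoint_le:
  assumes "isometric_op V"
  shows "norm (cadjoint V x) \<le> norm x"
proof -
  have "(norm (cadjoint V x))\<^sup>2 \<le> (norm x)\<^sup>2"
    using norm_diff_range_projection[OF assms, of x] by (metis diff_ge_0_iff_ge zero_le_power2)
  then show ?thesis by (rule power2_le_imp_le) simp
qed

section \<open>Commutation of an isometry with an adjoint\<close>

lemma adjoint_commutes_sym:
  assumes "isometric_op A" "isometric_op B"
    and "\<And>x. cadjoint A (B x) = B (cadjoint A x)"
  shows "cadjoint B (A x) = A (cadjoint B x)"
  \<comment> \<open>The goal is the adjoint of the assumed relation, so it is tested against
    vectors.\<close>
  by (rule cinner_ext) (simp add: assms(3)
      flip: isometric_op_adjoint[OF assms(2)] isometric_op_adjoint'[OF assms(1)])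

text \<open>Moving \<open>A*\<close> across and using \<open>A B = B A\<close> shows that
  \<open>B A* y\<close> has the same inner product with \<open>A* B y\<close> as with itself. So it
  is orthogonal to the commutator term, and Pythagoras applies.\<close>

lemma norm_cadjoint_commutator:
  assumes A: "isometric_op A" and B: "isometric_op B" and AB: "A \<circ> B = B \<circ> A"
  shows "(norm (cadjoint A (B y)))\<^sup>2
    = (norm (cadjoint A y))\<^sup>2 + (norm (cadjoint A (B y) - B (cadjoint A y)))\<^sup>2"
proof -
  let ?a = "cadjoint A y"
  have "cinner (cadjoint A (B y)) (B ?a) = cinner ?a ?a"
    by (simp add: isometric_op_adjoint'[OF A] comp_eq_dest[OF AB] cinner_isometric_op[OF B])
  then have "inner (cadjoint A (B y)) (B ?a) = (norm ?a)\<^sup>2"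
    by (simp add: inner_eq_Re_cinner power2_norm_eq_inner)
  moreover have "(norm (B ?a))\<^sup>2 = (norm ?a)\<^sup>2" by (simp add: isometric_op_norm[OF B])
  ultimately show ?thesis
    unfolding power2_norm_eq_inner
    by (simp add: inner_diff_left inner_diff_right inner_commute)
qed

lemma adjoint_commutes_of_funpow:
  assumes A: "isometric_op A" and B: "isometric_op B" and AB: "A \<circ> B = B \<circ> A"
    and n: "n \<ge> 1" and comm: "\<And>x. cadjoint A ((B ^^ n) x) = (B ^^ n) (cadjoint A x)"
  shows "cadjoint A (B x) = B (cadjoint A x)"
proof -
  define C where "C y = cadjoint A (B y) - B (cadjoint A y)" for y
  define g where "g y = (norm (cadjoint A y))\<^sup>2" for y
  note Bn = isometric_op_funpow[OF B, of n]
  have step: "g (B y) = g y + (norm (C y))\<^sup>2" for y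
    using norm_cadjoint_commutator[OF A B AB] by (simp add: g_def C_def)
  have mono: "g y \<le> g ((B ^^ j) y)" for j y
  proof (induction j)
    case (Suc j)
    then show ?case using step[of "(B ^^ j) y"] by (simp add: add_increasing2)
  qed simp
  \<comment> \<open>The first of the \<open>n\<close> factors already gains the commutator term; the
    others do not decrease \<open>g\<close>.\<close>
  have drop: "g y + (norm (C y))\<^sup>2 \<le> g ((B ^^ n) y)" for y
  proof -
    obtain j where "n = Suc j" using n by (cases n) auto
    then show ?thesis using mono[of "B y" j] step[of y] by (simp add: funpow_swap1)
  qed
  have "C ((B ^^ n) y) = (B ^^ n) (C y)" for y
    by (simp add: C_def isometric_op_diff[OF Bn] comm flip: funpow_swap1)
      (simp add: comm funpow_swap1)
  then have normC: "norm (C ((B ^^ n) y)) = norm (C y)" for y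
    by (simp add: isometric_op_norm[OF Bn])
  \<comment> \<open>Each block of \<open>n\<close> factors gains the same amount, since
    \<open>normC\<close> keeps the norm of \<open>C\<close> constant along the orbit under
    \<open>B ^^ n\<close>.\<close>
  have iter: "real k * (norm (C y))\<^sup>2 \<le> g (((B ^^ n) ^^ k) y)" for k y
  proof (induction k arbitrary: y)
    case 0
    show ?case by (simp add: g_def)
  next
    case (Suc k)
    have nC: "norm (C (((B ^^ n) ^^ k) y)) = norm (C y)"
      by (induction k) (simp_all add: normC)
    show ?case
      using Suc[of y] drop[of "((B ^^ n) ^^ k) y"] by (simp add: nC algebra_simps)
  qed
  have "real k * (norm (C x))\<^sup>2 \<le> (norm x)\<^sup>2" for k
  proof -
    have "g (((B ^^ n) ^^ k) x) \<le> (norm (((B ^^ n) ^^ k) x))\<^sup>2"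
      unfolding g_def by (intro power_mono norm_cadjoint_le A) simp
    also have "\<dots> = (norm x)\<^sup>2"
      by (simp add: isometric_op_norm[OF isometric_op_funpow[OF Bn]])
    finally show ?thesis using iter[of k x] by linarith
  qed
  then have "(norm (C x))\<^sup>2 \<le> 0"
    by (meson not_le reals_Archimedean3)
  then show ?thesis by (simp add: C_def)
qed

lemma W_space_eq_kernel_funpow:
  assumes "isometric_op V"
  shows "W_space V m = {x. cadjoint (V ^^ m) x = 0}"
  \<comment> \<open>Exponent 1 on the isometry \<open>V ^^ m\<close> yields the adjoint of the power
    instead of a power of the adjoint, so \<open>V ^^ m\<close> can be treated as a single
    isometry.\<close>
  using W_space_eq_kernel[OF isometric_op_funpow[OF assms], of m 1] by (simp add: W_space_def)

lemma kernel_invariant_iff_adjoint_commutes: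
  assumes A: "isometric_op A" and B: "isometric_op B" and AB: "A \<circ> B = B \<circ> A"
  shows "B ` {x. cadjoint A x = 0} \<subseteq> {x. cadjoint A x = 0}
    \<longleftrightarrow> (\<forall>x. cadjoint A (B x) = B (cadjoint A x))"
proof
  assume inv: "B ` {x. cadjoint A x = 0} \<subseteq> {x. cadjoint A x = 0}"
  show "\<forall>x. cadjoint A (B x) = B (cadjoint A x)"
  proof
    fix x
    have "cadjoint A (x - A (cadjoint A x)) = 0"
      by (simp add: cadjoint_diff[OF A] cadjoint_isometric_op[OF A])
    then have "cadjoint A (B (x - A (cadjoint A x))) = 0" using inv by blast
    \<comment> \<open>The subtracted term is
      \<open>A* B A A* x = A* A B A* x = B A* x\<close>.\<close>
    then show "cadjoint A (B x) = B (cadjoint A x)"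
      by (simp add: isometric_op_diff[OF B] cadjoint_diff[OF A] cadjoint_isometric_op[OF A]
          comp_eq_dest[OF AB, symmetric])
  qed
next
  assume "\<forall>x. cadjoint A (B x) = B (cadjoint A x)"
  then show "B ` {x. cadjoint A x = 0} \<subseteq> {x. cadjoint A x = 0}"
    \<comment> \<open>This instance says \<open>B 0 = 0\<close>.\<close>
    using isometric_op_diff[OF B, of 0 0] by auto
qed

lemma adjoint_commutes_funpow_iff:
  assumes A: "isometric_op A" and B: "isometric_op B" and AB: "A \<circ> B = B \<circ> A"
    and n: "n \<ge> 1"
  shows "(\<forall>x. cadjoint A ((B ^^ n) x) = (B ^^ n) (cadjoint A x))
    \<longleftrightarrow> (\<forall>x. cadjoint A (B x) = B (cadjoint A x))"
proof
  assume "\<forall>x. cadjoint A (B x) = B (cadjoint A x)"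
  then have "cadjoint A ((B ^^ k) x) = (B ^^ k) (cadjoint A x)" for k x
    by (induction k) simp_all
  then show "\<forall>x. cadjoint A ((B ^^ n) x) = (B ^^ n) (cadjoint A x)" by blast
qed (use adjoint_commutes_of_funpow[OF A B AB n] in blast)

lemma funpow_comp_commute:
  assumes "f \<circ> g = g \<circ> f"
  shows "(f ^^ k) \<circ> g = g \<circ> (f ^^ k)"
proof
  show "((f ^^ k) \<circ> g) x = (g \<circ> (f ^^ k)) x" for x
    by (induction k) (simp_all add: comp_eq_dest[OF assms])
qed

lemma W_space_invariant_iff_adjoint_commutes:
  assumes A: "isometric_op A" and B: "isometric_op B" and AB: "A \<circ> B = B \<circ> A"
    and m: "m \<ge> 1" and n: "n \<ge> 1"
  shows "(B ^^ n) ` W_space A m \<subseteq> W_space A m \<longleftrightarrow> (\<forall>x. cadjoint A (B x) = B (cadjoint A x))"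
proof -
  note Am = isometric_op_funpow[OF A, of m] and Bn = isometric_op_funpow[OF B, of n]
  have AmB: "(A ^^ m) \<circ> B = B \<circ> (A ^^ m)"
    by (rule funpow_comp_commute[OF AB])
  have AmBn: "(A ^^ m) \<circ> (B ^^ n) = (B ^^ n) \<circ> (A ^^ m)"
    by (rule funpow_comp_commute[OF AmB[symmetric], symmetric])
  have sym: "(\<forall>x. cadjoint U (V x) = V (cadjoint U x)) \<longleftrightarrow> (\<forall>x. cadjoint V (U x) = U (cadjoint V x))"
    if "isometric_op U" "isometric_op V" for U V :: "'a \<Rightarrow> 'a"
    using adjoint_commutes_sym that by metis
  have "(B ^^ n) ` W_space A m \<subseteq> W_space A m
      \<longleftrightarrow> (\<forall>x. cadjoint (A ^^ m) ((B ^^ n) x) = (B ^^ n) (cadjoint (A ^^ m) x))"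
    unfolding W_space_eq_kernel_funpow[OF A]
    by (rule kernel_invariant_iff_adjoint_commutes[OF Am Bn AmBn])
  also have "\<dots> \<longleftrightarrow> (\<forall>x. cadjoint (A ^^ m) (B x) = B (cadjoint (A ^^ m) x))"
    by (rule adjoint_commutes_funpow_iff[OF Am B AmB n])
  \<comment> \<open>Taking adjoints moves \<open>A ^^ m\<close> to the unstarred side, where its
    exponent can be removed like that of \<open>B\<close>.\<close>
  also have "\<dots> \<longleftrightarrow> (\<forall>x. cadjoint B ((A ^^ m) x) = (A ^^ m) (cadjoint B x))"
    by (rule sym[OF Am B])
  also have "\<dots> \<longleftrightarrow> (\<forall>x. cadjoint B (A x) = A (cadjoint B x))"
    by (rule adjoint_commutes_funpow_iff[OF B A AB[symmetric] m])
  also have "\<dots> \<longleftrightarrow> (\<forall>x. cadjoint A (B x) = B (cadjoint A x))"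
    by (rule sym[OF B A])
  finally show ?thesis .
qed

section \<open>The quadratic form of \<open>H_op\<close>\<close>

lemma clinear_H_op:
  assumes "isometric_op T1" "isometric_op T2"
  shows "clinear (H_op T1 T2)"
proof -
  have T: "clinear T1" "clinear T2" "clinear (cadjoint T1)" "clinear (cadjoint T2)"
    using assms clinear_cadjoint by (auto simp: isometric_op_def)
  have add: "T (x + y) = T x + T y" if "clinear T" for T :: "'a \<Rightarrow> 'a" and x y
    using that by (simp add: clinear_iff)
  show ?thesis
    unfolding clinear_iff H_op_def numeral_2_eq_2
    by (simp add: add[OF T(1)] add[OF T(2)] add[OF T(3)] add[OF T(4)] clinear_scaleC[OF T(1)]
        clinear_scaleC[OF T(2)] clinear_scaleC[OF T(3)] clinear_scaleC[OF T(4)]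
        scaleC_add_right scaleC_diff_right)
qed

text \<open>Moving the outer isometries across turns the four terms, with \<open>y = B* x\<close>,
  into the squared norms of \<open>y\<close>, \<open>A* y\<close>, \<open>B* y\<close> and
  \<open>A* B* y\<close>, with signs \<open>+ - - +\<close>.\<close>

lemma cinner_H_op:
  assumes A: "isometric_op A" and B: "isometric_op B" and AB: "A \<circ> B = B \<circ> A"
  defines "f \<equiv> \<lambda>y. (norm y)\<^sup>2 - (norm (cadjoint A y))\<^sup>2"
  shows "cinner (H_op (A \<circ> B) B x) x
    = complex_of_real (f (cadjoint B x) - f (cadjoint B (cadjoint B x)))"
proof -
  have adj: "cadjoint (A \<circ> B) = cadjoint A \<circ> cadjoint B"
    using cadjoint_compose[OF B A] by (simp add: AB)
  have comm: "cadjoint B (cadjoint A y) = cadjoint A (cadjoint B y)" for y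
    using cadjoint_compose[OF A B] adj by (metis comp_apply)
  show ?thesis
    unfolding f_def of_real_diff cinner_self[symmetric]
    by (simp add: H_op_def numeral_2_eq_2 cinner_add_left cinner_diff_left adj comm
        isometric_op_adjoint[OF A] isometric_op_adjoint[OF B])
qed

lemma positive_H_op_iff_adjoint_commutes:
  assumes A: "isometric_op A" and B: "isometric_op B" and AB: "A \<circ> B = B \<circ> A"
  shows "positive_op (H_op (A \<circ> B) B) \<longleftrightarrow> (\<forall>x. cadjoint A (B x) = B (cadjoint A x))"
proof -
  define f where "f y = (norm y)\<^sup>2 - (norm (cadjoint A y))\<^sup>2" for y
  have form: "cinner (H_op (A \<circ> B) B x) x
      = complex_of_real (f (cadjoint B x) - f (cadjoint B (cadjoint B x)))" for x
    unfolding f_def by (rule cinner_H_op[OF A B AB])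
  have "positive_op (H_op (A \<circ> B) B)
      \<longleftrightarrow> (\<forall>x. f (cadjoint B (cadjoint B x)) \<le> f (cadjoint B x))"
    unfolding positive_op_def form
    using clinear_H_op[OF isometric_op_compose[OF A B] B] by simp
  \<comment> \<open>\<open>B*\<close> is onto because \<open>B* B\<close> is the identity.\<close>
  also have "\<dots> \<longleftrightarrow> (\<forall>y. f (cadjoint B y) \<le> f y)"
    by (metis cadjoint_isometric_op[OF B])
  also have "\<dots> \<longleftrightarrow> (\<forall>x. cadjoint A (B x) = B (cadjoint A x))"
  proof
    assume le: "\<forall>y. f (cadjoint B y) \<le> f y"
    show "\<forall>x. cadjoint A (B x) = B (cadjoint A x)"
    proof
      fix x
      have "f x \<le> f (B x)"
        using le[rule_format, of "B x"] by (simp add: cadjoint_isometric_op[OF B])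
      \<comment> \<open>As \<open>x\<close> and \<open>B x\<close> have equal norms,
        \<open>A* B x\<close> is no longer than \<open>A* x\<close>, so the Pythagorean excess
        vanishes.\<close>
      then have "(norm (cadjoint A (B x) - B (cadjoint A x)))\<^sup>2 \<le> 0"
        using norm_cadjoint_commutator[OF A B AB, of x] isometric_op_norm[OF B, of x]
        by (simp add: f_def)
      then show "cadjoint A (B x) = B (cadjoint A x)" by simp
    qed
  next
    assume dc: "\<forall>x. cadjoint A (B x) = B (cadjoint A x)"
    show "\<forall>y. f (cadjoint B y) \<le> f y"
    proof
      fix y
      have "cadjoint B (cadjoint A y) = cadjoint A (cadjoint B y)"
        using cadjoint_compose[OF A B] cadjoint_compose[OF B A] AB by (metis comp_apply)
      \<comment> \<open>\<open>f y\<close> is the squared length of the projection of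
        \<open>y\<close> onto the kernel of \<open>A*\<close>; the contraction \<open>B*\<close>
        commutes with this projection.\<close>
      then have "cadjoint B (y - A (cadjoint A y))
          = cadjoint B y - A (cadjoint A (cadjoint B y))"
        using adjoint_commutes_sym[OF A B] dc by (simp add: cadjoint_diff[OF B])
      then have "norm (cadjoint B y - A (cadjoint A (cadjoint B y))) \<le> norm (y - A (cadjoint A y))"
        using norm_cadjoint_le[OF B] by metis
      then show "f (cadjoint B y) \<le> f y"
        unfolding f_def norm_diff_range_projection[OF A, symmetric] by (intro power_mono) simp_all
    qed
  qed
  finally show ?thesis .
qed

theorem proposition2p10:
  fixes V1 V2 :: "'a::chilbert_space \<Rightarrow> 'a" and m n :: nat
  assumes "m \<ge> 1" and "n \<ge> 1"
    and "isometric_op V1" and "isometric_op V2" and "V1 \<circ> V2 = V2 \<circ> V1"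
  shows "positive_op (H_op (V1 \<circ> V2) V2) \<longleftrightarrow> (V2 ^^ n) ` W_space V1 m \<subseteq> W_space V1 m"
  using positive_H_op_iff_adjoint_commutes[OF assms(3-5)]
    W_space_invariant_iff_adjoint_commutes[OF assms(3-5) assms(1,2)] by simp

end
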